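(* Let $\mathbf{k}$ be a commutative ring and $n\in\mathbb{N}$. There exists a basis $(v_1,v_2,\ldots,v_{n!})$ of the $\mathbf{k}$-module $\mathbf{k}[S_n]$ such that for all $\lambda_1,\lambda_2,\ldots,\lambda_n\in\mathbf{k}$, the $\mathbf{k}$-module endomorphism $R(\lambda_1t_1+\lambda_2t_2+\cdots+\lambda_nt_n)$ of $\mathbf{k}[S_n]$ is represented by an upper-triangular matrix with respect to this basis. (In particular, the basis does not depend on $\lambda_1,\ldots,\lambda_n$.)
   Context: $\mathbb{N}=\{0,1,2,\ldots\}$ and $[n]=\{1,2,\ldots,n\}$. $S_n$ is the group of permutations of $[n]$, with product $(\pi\sigma)(i)=\pi(\sigma(i))$, and $\mathbf{k}[S_n]$ is its group algebra. For distinct $i_1,\ldots,i_k\in[n]$, $\operatorname{cyc}_{i_1,\ldots,i_k}\in S_n$ is the permutation sending $i_1,i_2,\ldots,i_{k-1},i_k$ to $i_2,i_3,\ldots,i_k,i_1$, respectively, and fixing all other elements (so $\operatorname{cyc}_i=\operatorname{id}$). For $\ell\in[n]$, $t_\ell:=\operatorname{cyc}_\ell+\operatorname{cyc}_{\ell,\ell+1}+\operatorname{cyc}_{\ell,\ell+1,\ell+2}+\cdots+\operatorname{cyc}_{\ell,\ell+1,\ldots,n}\in\mathbf{k}[S_n]$. For $x\in\mathbf{k}[S_n]$, $R(x):\mathbf{k}[S_n]\to\mathbf{k}[S_n]$ is the $\mathbf{k}$-linear map $y\mapsto yx$. *)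

theory Defs
  imports
    "HOL-Combinatorics.Cycles"
    "HOL-Library.Function_Algebras"
    "Jordan_Normal_Form.Matrix"
begin

(* The coefficient ring has sort {comm_ring, comm_monoid_mult}, which is exactly a commutative
   ring with 1.  The class comm_ring_1 would in addition require 0 \<noteq> 1 and so exclude the
   zero ring.

   An element of k[S_n] is its coefficient function, extended by 0 to all functions
   nat => nat that are not permutations of {1..n}.  Addition, zero and finite sums are the
   pointwise ones of HOL-Library.Function_Algebras; the pointwise product provided there is
   not the product of k[S_n]. *)

type_synonym 'k galg = "(nat \<Rightarrow> nat) \<Rightarrow> 'k"

definition Sym :: "nat \<Rightarrow> (nat \<Rightarrow> nat) set" where
  "Sym n = {\<pi>. \<pi> permutes {1..n}}"

definition group_algebra :: "nat \<Rightarrow> ('k::{comm_ring,comm_monoid_mult}) galg set" where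
  "group_algebra n = {x. \<forall>\<pi>. \<pi> \<notin> Sym n \<longrightarrow> x \<pi> = 0}"

definition ga_perm :: "(nat \<Rightarrow> nat) \<Rightarrow> ('k::{comm_ring,comm_monoid_mult}) galg" where
  "ga_perm \<pi> = (\<lambda>\<rho>. if \<rho> = \<pi> then 1 else 0)"

definition ga_scale :: "'k::{comm_ring,comm_monoid_mult} \<Rightarrow> 'k galg \<Rightarrow> 'k galg"
    (infixr "\<cdot>\<^sub>g" 75) where
  "c \<cdot>\<^sub>g x = (\<lambda>\<pi>. c * x \<pi>)"

definition ga_mult :: "nat \<Rightarrow> ('k::{comm_ring,comm_monoid_mult}) galg \<Rightarrow> 'k galg \<Rightarrow> 'k galg" where
  "ga_mult n x y = (\<Sum>\<pi>\<in>Sym n. \<Sum>\<sigma>\<in>Sym n. (x \<pi> * y \<sigma>) \<cdot>\<^sub>g ga_perm (\<pi> \<circ> \<sigma>))"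

definition R :: "nat \<Rightarrow> ('k::{comm_ring,comm_monoid_mult}) galg \<Rightarrow> 'k galg \<Rightarrow> 'k galg" where
  "R n x = (\<lambda>y. ga_mult n y x)"

(* cycle_of_list [i1, ..., ik] sends i1 to i2, ..., ik to i1; see cycle_of_list_upt below. *)
definition t :: "nat \<Rightarrow> nat \<Rightarrow> ('k::{comm_ring,comm_monoid_mult}) galg" where
  "t n l = (\<Sum>j=l..n. ga_perm (cycle_of_list [l..<Suc j]))"

(* Bases are families (lists), not sets: over the zero ring the members of a basis coincide. *)
definition is_basis :: "('k::{comm_ring,comm_monoid_mult}) galg list \<Rightarrow> 'k galg set \<Rightarrow> bool" where
  "is_basis vs M \<longleftrightarrow> set vs \<subseteq> M
     \<and> (\<forall>c :: nat \<Rightarrow> 'k. (\<Sum>i<length vs. c i \<cdot>\<^sub>g vs ! i) = 0 \<longrightarrow> (\<forall>i<length vs. c i = 0))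
     \<and> (\<forall>x\<in>M. \<exists>c :: nat \<Rightarrow> 'k. x = (\<Sum>i<length vs. c i \<cdot>\<^sub>g vs ! i))"

(* Column convention: column j of A holds the coordinates of f (vs ! j). *)
definition represents ::
    "('k::{comm_ring,comm_monoid_mult}) mat \<Rightarrow> ('k galg \<Rightarrow> 'k galg) \<Rightarrow> 'k galg list \<Rightarrow> bool" where
  "represents A f vs \<longleftrightarrow> A \<in> carrier_mat (length vs) (length vs)
     \<and> (\<forall>j<length vs. f (vs ! j) = (\<Sum>i<length vs. A $$ (i, j) \<cdot>\<^sub>g vs ! i))"


lemma sum_galg_apply: "(\<Sum>i\<in>I. f i) \<pi> = (\<Sum>i\<in>I. f i \<pi>)"
  for f :: "'i \<Rightarrow> ('k::{comm_ring,comm_monoid_mult}) galg"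
  by (induction I rule: infinite_finite_induct) auto

lemma finite_Sym [simp]: "finite (Sym n)"
  by (simp add: Sym_def finite_permutations)

lemma ga_mult_perm:
  assumes "\<pi> \<in> Sym n" "\<sigma> \<in> Sym n"
  shows "ga_mult n (ga_perm \<pi>) (ga_perm \<sigma>) = (ga_perm (\<pi> \<circ> \<sigma>) :: 'k::{comm_ring,comm_monoid_mult} galg)"
proof
  fix \<rho>
  have "ga_mult n (ga_perm \<pi>) (ga_perm \<sigma>) \<rho> =
      (\<Sum>a\<in>Sym n. \<Sum>b\<in>Sym n. if b = \<sigma> then (if a = \<pi> then ga_perm (a \<circ> b) \<rho> else (0::'k)) else 0)"
    unfolding ga_mult_def sum_galg_apply
    by (intro sum.cong refl) (simp add: ga_scale_def ga_perm_def)
  also have "\<dots> = ga_perm (\<pi> \<circ> \<sigma>) \<rho>"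
    using assms by (simp add: sum.delta)
  finally show "ga_mult n (ga_perm \<pi>) (ga_perm \<sigma>) \<rho> = (ga_perm (\<pi> \<circ> \<sigma>) \<rho> :: 'k)" .
qed

lemma R_closed: "R n x y \<in> group_algebra n"
  unfolding group_algebra_def
proof (intro CollectI allI impI)
  fix \<rho> assume "\<rho> \<notin> Sym n"
  then have "\<rho> \<noteq> \<pi> \<circ> \<sigma>" if "\<pi> \<in> Sym n" "\<sigma> \<in> Sym n" for \<pi> \<sigma>
    using that permutes_compose by (auto simp: Sym_def)
  then show "R n x y \<rho> = 0"
    unfolding R_def ga_mult_def sum_galg_apply
    by (intro sum.neutral ballI) (simp add: ga_scale_def ga_perm_def)
qed

lemma R_add: "R n x (y + z) = R n x y + R n x z"
  by (rule ext) (simp add: R_def ga_mult_def sum_galg_apply ga_scale_def distrib_right sum.distrib)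

lemma R_scale: "R n x (c \<cdot>\<^sub>g y) = c \<cdot>\<^sub>g R n x y"
  by (rule ext) (simp add: R_def ga_mult_def sum_galg_apply ga_scale_def sum_distrib_left mult.assoc)

lemma cycle_of_list_upt:
  assumes "l \<le> j"
  shows "cycle_of_list [l..<Suc j] i = (if l \<le> i \<and> i < j then Suc i else if i = j then l else i)"
  using assms
proof (induction l rule: inc_induct)
  case base
  then show ?case by simp
next
  case (step m)
  from step.hyps have "[m..<Suc j] = m # Suc m # [Suc (Suc m)..<Suc j]"
    "[Suc m..<Suc j] = Suc m # [Suc (Suc m)..<Suc j]"
    by (simp_all add: upt_conv_Cons)
  then have "cycle_of_list [m..<Suc j] i = transpose m (Suc m) (cycle_of_list [Suc m..<Suc j] i)"
    by simp
  then show ?case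
    unfolding step.IH using step.hyps by (auto simp: transpose_def)
qed

end

theory Submission
  imports Defs
begin

text \<open>
  Write a permutation \<open>w\<close> as the word \<open>w(1) \<dots> w(n)\<close>. Multiplying it from the right by the cycle
  \<open>(l, l+1, \<dots>, j)\<close> takes the letter out of position \<open>l\<close> and reinserts it at position \<open>j\<close>, and
  multiplying it by the simple transposition \<open>s i\<close> swaps the letters in positions \<open>i\<close> and \<open>i+1\<close>.

  For a set \<open>I\<close> of positions let \<open>F(I)\<close> be the space of all \<open>q\<close> with \<open>q (s i) = q\<close> whenever neither
  \<open>i\<close> nor \<open>i+1\<close> is in \<open>I\<close>. The heart of the proof is that on \<open>F(I)\<close> each \<open>t l\<close> acts as a scalar
  modulo the sum of those \<open>F(J)\<close> for which the elements of \<open>J\<close> have a smaller sum than those of \<open>I\<close>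
  (lemma \<open>cycle_sum_triangular\<close>). Let \<open>p\<close> be the first element of \<open>I\<close> (or \<open>n+1\<close>, if there
  is none) with \<open>p \<ge> l\<close>. Reinserting at a position below \<open>p\<close> does nothing to \<open>q\<close>, and this yields the
  scalar \<open>p - l\<close>. The remaining positions are cut into the intervals \<open>{a..<c}\<close> between consecutive
  elements of \<open>I \<union> {n+1}\<close>. The sum over one interval is symmetric in the way described by the set
  obtained from \<open>I\<close> on moving each of its elements in \<open>{l..a}\<close> down by one, because taking the
  letter out of position \<open>l\<close> moves the letters behind it forward (lemma \<open>insertion_invariant\<close>).
  Thus the sum of the set strictly decreases.

  It remains to find one basis adapted to all of these spaces at once. Let \<open>run_sum n w\<close> be the sum
  of all words obtained from \<open>w\<close> by permuting letters inside the maximal decreasing runs of \<open>w\<close>. Among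
  these words \<open>w\<close> is the lexicographically greatest, so the run sums form a basis of the group algebra.
  Moreover, for each set \<open>P\<close> of positions, the elements invariant under all \<open>s i\<close> with \<open>i \<in> P\<close> are
  combinations of the run sums of those \<open>w\<close> whose descent set contains \<open>P\<close>: the lexicographically
  greatest word that occurs in an invariant element must descend at every position in \<open>P\<close>
  (lemma \<open>invariants_in_run_span\<close>). Hence, with \<open>level n w\<close> the least sum of a set \<open>I\<close> such that
  \<open>run_sum n w\<close> visibly lies in \<open>F(I)\<close>, every \<open>t l\<close> maps a run sum to a multiple of itself plus a
  combination of run sums of smaller level. Listing the run sums by increasing level makes all these
  matrices upper-triangular simultaneously.
\<close>

(* From here on inv is the inverse of a function, not the inverse in a group structure. *)
unbundle no m_inv_syntax

section \<open>Right translation by cycles\<close>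

definition right_act :: "('k::{comm_ring,comm_monoid_mult}) galg \<Rightarrow> (nat \<Rightarrow> nat) \<Rightarrow> 'k galg"
    (infixl "\<star>" 70) where
  "q \<star> \<sigma> = (\<lambda>\<pi>. q (\<pi> \<circ> inv \<sigma>))"

abbreviation s :: "nat \<Rightarrow> nat \<Rightarrow> nat" where
  "s i \<equiv> transpose i (Suc i)"

definition cyc :: "nat \<Rightarrow> nat \<Rightarrow> nat \<Rightarrow> nat" where
  "cyc l j = cycle_of_list [l..<Suc j]"

lemma cyc_apply:
  "l \<le> j \<Longrightarrow> cyc l j i = (if l \<le> i \<and> i < j then Suc i else if i = j then l else i)"
  unfolding cyc_def by (rule cycle_of_list_upt)

lemma cyc_permutes: "cyc l j permutes {l..j}"
proof -
  have "set [l..<Suc j] = {l..j}" by auto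
  moreover have "cycle_of_list [l..<Suc j] permutes set [l..<Suc j]"
    by (rule cycle_permutes)
  ultimately show ?thesis by (simp add: cyc_def)
qed

lemma cyc_in_Sym: "1 \<le> l \<Longrightarrow> j \<le> n \<Longrightarrow> cyc l j \<in> Sym n"
  unfolding Sym_def using permutes_subset[OF cyc_permutes[of l j]] by auto

lemma bij_cyc [simp]: "bij (cyc l j)"
  using cyc_permutes permutes_bij by blast

lemma s_in_Sym: "i \<in> {1..<n} \<Longrightarrow> s i \<in> Sym n"
  unfolding Sym_def by (auto intro: permutes_swap_id)

lemma Sym_comp: "\<sigma> \<in> Sym n \<Longrightarrow> \<tau> \<in> Sym n \<Longrightarrow> \<sigma> \<circ> \<tau> \<in> Sym n"
  unfolding Sym_def by (simp add: permutes_compose)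

lemma Sym_comp_cancel: "\<tau> \<in> Sym n \<Longrightarrow> \<sigma> \<circ> \<tau> \<in> Sym n \<longleftrightarrow> \<sigma> \<in> Sym n"
proof
  assume \<tau>: "\<tau> \<in> Sym n" and "\<sigma> \<circ> \<tau> \<in> Sym n"
  moreover have "inv \<tau> \<in> Sym n" using \<tau> by (simp add: Sym_def permutes_inv)
  ultimately have "(\<sigma> \<circ> \<tau>) \<circ> inv \<tau> \<in> Sym n" by (blast intro: Sym_comp[of "\<sigma> \<circ> \<tau>"])
  moreover have "(\<sigma> \<circ> \<tau>) \<circ> inv \<tau> = \<sigma>"
    using \<tau> by (simp add: Sym_def comp_assoc permutes_inv_o)
  ultimately show "\<sigma> \<in> Sym n" by simp
qed (simp add: Sym_comp)

lemma right_act_comp: "bij \<sigma> \<Longrightarrow> bij \<tau> \<Longrightarrow> q \<star> \<sigma> \<star> \<tau> = q \<star> (\<sigma> \<circ> \<tau>)"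
  by (simp add: right_act_def o_inv_distrib comp_assoc)

lemma right_act_s: "(q \<star> s i) \<pi> = q (\<pi> \<circ> s i)"
  by (simp add: right_act_def)

lemma right_act_sum: "(\<Sum>j\<in>A. f j) \<star> \<sigma> = (\<Sum>j\<in>A. f j \<star> \<sigma>)"
  by (rule ext) (simp add: right_act_def sum_galg_apply)

lemma right_act_closed:
  "\<sigma> \<in> Sym n \<Longrightarrow> q \<in> group_algebra n \<Longrightarrow> q \<star> \<sigma> \<in> group_algebra n"
  unfolding group_algebra_def right_act_def
  using Sym_comp_cancel[of "inv \<sigma>" n] by (auto simp: Sym_def permutes_inv)

lemma ga_mult_ga_perm:
  assumes "\<sigma> \<in> Sym n" "y \<in> group_algebra n"
  shows "ga_mult n y (ga_perm \<sigma>) = y \<star> \<sigma>"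
proof
  fix \<rho> :: "nat \<Rightarrow> nat"
  have inv: "inv \<sigma> \<in> Sym n" using assms by (simp add: Sym_def permutes_inv)
  have eq: "\<rho> = \<pi> \<circ> \<sigma> \<longleftrightarrow> \<pi> = \<rho> \<circ> inv \<sigma>" for \<pi>
    using assms(1) by (auto simp: Sym_def comp_assoc permutes_inv_o)
  have "ga_mult n y (ga_perm \<sigma>) \<rho> =
      (\<Sum>a\<in>Sym n. \<Sum>b\<in>Sym n. if b = \<sigma> then (if a = \<rho> \<circ> inv \<sigma> then y a else 0) else 0)"
    unfolding ga_mult_def sum_galg_apply
    by (intro sum.cong refl) (auto simp: ga_scale_def ga_perm_def eq)
  also have "\<dots> = (if \<rho> \<circ> inv \<sigma> \<in> Sym n then y (\<rho> \<circ> inv \<sigma>) else 0)"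
    using assms(1) by (simp add: sum.delta)
  also have "\<dots> = (y \<star> \<sigma>) \<rho>"
    using assms(2) by (auto simp: right_act_def group_algebra_def)
  finally show "ga_mult n y (ga_perm \<sigma>) \<rho> = (y \<star> \<sigma>) \<rho>" .
qed

lemma ga_mult_sum_right: "ga_mult n y (\<Sum>i\<in>A. f i) = (\<Sum>i\<in>A. ga_mult n y (f i))"
proof (induction A rule: infinite_finite_induct)
  case (insert x F)
  have add: "ga_mult n y (f x + g) = ga_mult n y (f x) + ga_mult n y g" for g
    by (rule ext)
      (simp add: ga_mult_def sum_galg_apply ga_scale_def distrib_left distrib_right sum.distrib)
  show ?case unfolding sum.insert[OF insert.hyps] add insert.IH by (rule refl)
qed (simp_all add: fun_eq_iff ga_mult_def sum_galg_apply ga_scale_def)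

lemma ga_mult_scale_right: "ga_mult n y (c \<cdot>\<^sub>g x) = c \<cdot>\<^sub>g ga_mult n y x"
  by (rule ext)
    (simp add: ga_mult_def sum_galg_apply ga_scale_def sum_distrib_left mult.assoc mult.left_commute)

lemma R_eq_right_act:
  assumes "y \<in> group_algebra n"
  shows "R n (\<Sum>l=1..n. lam l \<cdot>\<^sub>g t n l) y = (\<Sum>l=1..n. lam l \<cdot>\<^sub>g (\<Sum>j=l..n. y \<star> cyc l j))"
proof -
  have "ga_mult n y (t n l) = (\<Sum>j=l..n. y \<star> cyc l j)" if "l \<in> {1..n}" for l
    unfolding t_def cyc_def[symmetric] ga_mult_sum_right
    by (intro sum.cong refl ga_mult_ga_perm cyc_in_Sym assms) (use that in auto)
  then show ?thesis
    by (simp add: R_def ga_mult_sum_right ga_mult_scale_right)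
qed

text \<open>
  The commutation rules below say how a symmetry of the word after a reinsertion arises from
  one of the word before it. A swap of two positions becomes, before the letter moves,
  a swap of the positions where those two letters came from. If the moved letter itself is
  swapped with a neighbour, it ends up one position further on or back.
\<close>
lemma cyc_s_extend: "l \<le> j \<Longrightarrow> cyc l j \<circ> s j = cyc l (Suc j)"
  by (rule ext) (auto simp: cyc_apply transpose_def)

lemma cyc_s_shrink: "l \<le> j \<Longrightarrow> cyc l (Suc j) \<circ> s j = cyc l j"
  by (rule ext) (auto simp: cyc_apply transpose_def)

lemma cyc_s_shift: "l \<le> i \<Longrightarrow> Suc i < j \<Longrightarrow> cyc l j \<circ> s i = s (Suc i) \<circ> cyc l j"
  by (rule ext) (auto simp: cyc_apply transpose_def)

lemma cyc_s_commute: "l \<le> j \<Longrightarrow> Suc i < l \<or> j < i \<Longrightarrow> cyc l j \<circ> s i = s i \<circ> cyc l j"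
  by (rule ext) (auto simp: cyc_apply transpose_def)

text \<open>
  After the letter in position \<open>i+1\<close> has been removed, the letters originally in positions \<open>i\<close>
  and \<open>i+2\<close> are neighbours. Their transposition is the product of the three simple ones.
\<close>
lemma cyc_s_below:
  "Suc i < j \<Longrightarrow> cyc (Suc i) j \<circ> s i = s i \<circ> s (Suc i) \<circ> s i \<circ> cyc (Suc i) j"
  by (rule ext) (auto simp: cyc_apply transpose_def)

section \<open>Invariants under adjacent swaps, and reinsertion of a letter\<close>

definition invariants :: "nat \<Rightarrow> nat set \<Rightarrow> ('k::{comm_ring,comm_monoid_mult}) galg set" where
  "invariants n P = {q \<in> group_algebra n. \<forall>i\<in>P. q \<star> s i = q}"

lemma invariants_diff: "x \<in> invariants n P \<Longrightarrow> y \<in> invariants n P \<Longrightarrow> x - y \<in> invariants n P"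
  by (auto simp: invariants_def group_algebra_def fun_eq_iff right_act_def)

lemma invariants_scale: "x \<in> invariants n P \<Longrightarrow> c \<cdot>\<^sub>g x \<in> invariants n P"
  by (auto simp: invariants_def group_algebra_def fun_eq_iff right_act_def ga_scale_def)

lemma invariants_sum: "(\<And>i. i \<in> A \<Longrightarrow> f i \<in> invariants n P) \<Longrightarrow> (\<Sum>i\<in>A. f i) \<in> invariants n P"
  by (simp add: invariants_def group_algebra_def right_act_sum sum_galg_apply)

lemma invariants_mono: "P \<subseteq> Q \<Longrightarrow> invariants n Q \<subseteq> invariants n P"
  by (auto simp: invariants_def)

text \<open>
  The swaps that touch no position in \<open>I\<close>; thus the space \<open>F(I)\<close> of the introduction is
  \<open>invariants n (nonshadow n I)\<close>.
\<close>
definition nonshadow :: "nat \<Rightarrow> nat set \<Rightarrow> nat set" where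
  "nonshadow n I = {i \<in> {1..<n}. i \<notin> I \<and> Suc i \<notin> I}"

lemma invariant_cyc:
  assumes "\<And>i. i \<in> {l..<j} \<Longrightarrow> q \<star> s i = q" "l \<le> j"
  shows "q \<star> cyc l j = q"
  using assms(2,1)
proof (induction j rule: dec_induct)
  case base
  have "cyc l l = id" by (rule ext) (simp add: cyc_apply)
  then show ?case by (simp only: right_act_def inv_id comp_id)
next
  case (step j)
  have "q \<star> cyc l (Suc j) = q \<star> cyc l j \<star> s j"
    using step.hyps by (simp add: right_act_comp cyc_s_extend)
  also have "\<dots> = q" using step by simp
  finally show ?case .
qed

text \<open>
  The set describing the symmetry that is left when a letter is taken out of position \<open>l\<close> and
  reinserted between \<open>a\<close> and the next element of \<open>I\<close>: letters in between have moved forward by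
  one position. The element \<open>1\<close> of \<open>I\<close> may move to \<open>0\<close>, where it imposes no condition.
\<close>
definition shift_down :: "nat \<Rightarrow> nat \<Rightarrow> nat set \<Rightarrow> nat set" where
  "shift_down l a I = {i \<in> I. i < l \<or> a < i} \<union> (\<lambda>i. i - 1) ` {i \<in> I. l \<le> i \<and> i \<le> a}"

lemma sum_shift_down:
  assumes "finite I" "a \<in> I" "1 \<le> l" "l \<le> a"
  shows "\<Sum>(shift_down l a I) < \<Sum>I"
proof -
  let ?A = "{i \<in> I. i < l \<or> a < i}" and ?B = "{i \<in> I. l \<le> i \<and> i \<le> a}"
  have fin: "finite ?A" "finite ?B" using assms by auto
  have "\<Sum>(shift_down l a I) \<le> \<Sum>?A + \<Sum>((\<lambda>i. i - 1) ` ?B)"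
    using fin sum.union_inter[of ?A "(\<lambda>i. i - 1) ` ?B" "\<lambda>i. i"] by (simp add: shift_down_def)
  also have "\<Sum>((\<lambda>i. i - 1) ` ?B) \<le> (\<Sum>i\<in>?B. i - 1)"
    using sum_image_le[of ?B "\<lambda>i. i" "\<lambda>i. i - 1"] fin by (simp add: o_def)
  also have "(\<Sum>i\<in>?B. i - 1) < \<Sum>?B"
    by (rule sum_strict_mono) (use assms fin in auto)
  also have "\<Sum>?A + \<Sum>?B = \<Sum>I"
  proof -
    have "\<Sum>(?A \<union> ?B) = \<Sum>?A + \<Sum>?B" using fin by (intro sum.union_disjoint) auto
    moreover have "?A \<union> ?B = I" by auto
    ultimately show ?thesis by simp
  qed
  finally show ?thesis by simp
qed

text \<open>
  Fix a swap \<open>s i\<close> allowed by the shifted set. Away from the interval \<open>{a..<c}\<close> it can be pulled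
  through each of the cycles separately, and becomes a swap (or a product of swaps) that fixes \<open>q\<close>.
  Inside the interval it exchanges the summands \<open>j = i\<close> and \<open>j = i + 1\<close>, in which the moved letter
  is one of the two that are swapped, and again fixes all the others. So only the sum over the whole
  interval is invariant, not its summands.
\<close>
lemma insertion_invariant:
  assumes q: "q \<in> invariants n (nonshadow n I)"
    and l: "1 \<le> l" "l \<le> a" and a: "a \<in> I" and c: "a < c" "c \<in> I \<or> c = Suc n" "c \<le> Suc n"
    and gap: "I \<inter> {a<..<c} = {}"
  shows "(\<Sum>j=a..<c. q \<star> cyc l j) \<in> invariants n (nonshadow n (shift_down l a I))"
proof -
  let ?J = "shift_down l a I"
  have qs: "q \<star> s i = q" if "1 \<le> i" "i < n" "i \<notin> I" "Suc i \<notin> I" for i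
    using q that by (auto simp: invariants_def nonshadow_def)
  have absorb: "q \<star> (s i \<circ> \<sigma>) = q \<star> \<sigma>"
    if "1 \<le> i" "i < n" "i \<notin> I" "Suc i \<notin> I" "bij \<sigma>" for i \<sigma>
    using qs[OF that(1-4)] right_act_comp[of "s i" \<sigma> q] that(5) by simp
  have ga: "q \<star> cyc l j \<in> group_algebra n" if "j \<in> {a..<c}" for j
    using q that l c by (intro right_act_closed cyc_in_Sym) (auto simp: invariants_def)
  have J: "k \<in> ?J" if "k \<in> I" "k < l \<or> a < k" for k using that by (auto simp: shift_down_def)
  have J': "k \<in> ?J" if "Suc k \<in> I" "l \<le> Suc k" "Suc k \<le> a" for k
    using that unfolding shift_down_def by force
  have main: "(\<Sum>j=a..<c. q \<star> cyc l j) \<star> s i = (\<Sum>j=a..<c. q \<star> cyc l j)"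
    if "i \<in> nonshadow n ?J" for i
  proof -
    from that have i: "1 \<le> i" "i < n" "i \<notin> ?J" "Suc i \<notin> ?J" by (auto simp: nonshadow_def)
    have eq: "(\<Sum>j=a..<c. q \<star> cyc l j) \<star> s i = (\<Sum>j=a..<c. q \<star> (cyc l j \<circ> s i))"
      by (simp add: right_act_sum right_act_comp)
    (* Either c is in I and stays in the shifted set, or c = n + 1 exceeds both i and i + 1. *)
    have ic: "Suc i \<noteq> c" "i \<noteq> c" using i J c by auto
    consider "Suc i < l" | "Suc i = l" | "l \<le> i" "Suc i < a" | "l \<le> i" "Suc i = a"
      | "a \<le> i" "Suc i < c" | "c < i"
      using ic l by linarith
    then show ?thesis
    proof cases
      case 1
      then have "i \<notin> I" "Suc i \<notin> I" using i J by auto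
      then show ?thesis unfolding eq
        by (intro sum.cong refl) (use 1 i l in \<open>simp add: cyc_s_commute absorb\<close>)
    next
      case 2
      have nI: "i \<notin> I" "Suc i \<notin> I" using i J J' 2 l by auto
      then have "l < a" using a 2 l by (metis le_neq_implies_less)
      then have "Suc (Suc i) \<notin> I" "Suc i < n" using i J' 2 c by auto
      moreover have "cyc l j \<circ> s i = s i \<circ> (s (Suc i) \<circ> (s i \<circ> cyc l j))"
        if "j \<in> {a..<c}" for j
        using cyc_s_below[of i j] that \<open>l < a\<close> unfolding 2[symmetric] by (simp add: comp_assoc)
      ultimately show ?thesis unfolding eq
        by (intro sum.cong refl) (use nI i(1,2) in \<open>simp add: absorb bij_comp\<close>)
    next
      case 3
      then have "Suc i \<notin> I" "Suc (Suc i) \<notin> I" "Suc i < n" using i J' c by auto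
      then show ?thesis unfolding eq
        by (intro sum.cong refl) (use 3 i in \<open>simp add: cyc_s_shift absorb\<close>)
    next
      case 4
      (* The element a of I has moved to i = a - 1, so s i is not an allowed swap. *)
      then have False using i J' a by auto
      then show ?thesis ..
    next
      case 5
      have nI: "k \<notin> I" if "a < k" "k < c" for k using gap that by auto
      (* The swap of i and i + 1 permutes the summands in the same way as it permutes the indices. *)
      show ?thesis unfolding eq
      proof (rule sum.reindex_bij_witness[where i = "s i" and j = "s i"])
        fix j assume j: "j \<in> {a..<c}"
        show "s i j \<in> {a..<c}" using 5 j by (auto simp: transpose_def)
        consider "j < i" | "j = i" | "j = Suc i" | "Suc i < j" by linarith
        then show "q \<star> cyc l (s i j) = q \<star> (cyc l j \<circ> s i)"
        proof cases
          case 1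
          then show ?thesis using i j l 5 nI[of i] nI[of "Suc i"]
            by (simp add: cyc_s_commute absorb)
        next
          case 2
          then show ?thesis using 5 l by (simp add: cyc_s_extend)
        next
          case 3
          then show ?thesis using 5 l by (simp add: cyc_s_shrink)
        next
          case 4
          then show ?thesis using i j l 5 c nI[of "Suc i"] nI[of "Suc (Suc i)"]
            by (simp add: cyc_s_shift absorb)
        qed
        show "s i j \<in> {a..<c}" by fact
      qed simp_all
    next
      case 6
      then have "i \<notin> I" "Suc i \<notin> I" using i J c by auto
      then show ?thesis unfolding eq
        by (intro sum.cong refl) (use 6 i l in \<open>simp add: cyc_s_commute absorb\<close>)
    qed
  qed
  moreover have "(\<Sum>j=a..<c. q \<star> cyc l j) \<in> group_algebra n"
    using ga by (auto simp: group_algebra_def sum_galg_apply intro!: sum.neutral)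
  ultimately show ?thesis by (auto simp: invariants_def)
qed


section \<open>Sums over descending runs\<close>

definition descents :: "nat \<Rightarrow> (nat \<Rightarrow> nat) \<Rightarrow> nat set" where
  "descents n w = {i \<in> {1..<n}. w (Suc i) < w i}"

text \<open>
  A labelling of positions that is constant on a run of positions linked by elements of \<open>P\<close> and
  increases at every position outside \<open>P\<close>. A permutation that preserves the labels is exactly
  an element of the Young subgroup generated by the swaps \<open>s i\<close> with \<open>i \<in> P\<close>.
\<close>
definition block :: "nat set \<Rightarrow> nat \<Rightarrow> nat" where
  "block P i = card {k. k < i \<and> k \<notin> P}"

lemma block_Suc: "i \<in> P \<Longrightarrow> block P (Suc i) = block P i"
proof -
  assume "i \<in> P"
  then have "{k. k < Suc i \<and> k \<notin> P} = {k. k < i \<and> k \<notin> P}" by (auto elim: less_SucE)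
  then show ?thesis by (simp only: block_def)
qed

lemma block_eq_interval:
  assumes "block P i = block P j" "i \<le> k" "k < j"
  shows "k \<in> P"
proof (rule ccontr)
  assume "k \<notin> P"
  have "{k. k < i \<and> k \<notin> P} \<subset> {k. k < j \<and> k \<notin> P}"
  proof
    show "{k. k < i \<and> k \<notin> P} \<subseteq> {k. k < j \<and> k \<notin> P}"
      using assms(2,3) by fastforce
    show "{k. k < i \<and> k \<notin> P} \<noteq> {k. k < j \<and> k \<notin> P}"
      using assms(2,3) \<open>k \<notin> P\<close> by (metis (mono_tags, lifting) mem_Collect_eq not_le)
  qed
  moreover have "finite {k. k < j \<and> k \<notin> P}" by simp
  ultimately have "block P i < block P j" unfolding block_def by (rule psubset_card_mono[rotated])
  with assms(1) show False by simp
qed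

definition run_sum :: "nat \<Rightarrow> (nat \<Rightarrow> nat) \<Rightarrow> ('k::{comm_ring,comm_monoid_mult}) galg" where
  "run_sum n w = (\<lambda>u. if \<exists>\<sigma>\<in>Sym n. u = w \<circ> \<sigma> \<and> block (descents n w) \<circ> \<sigma> = block (descents n w)
    then 1 else 0)"

lemma run_sum_self: "run_sum n w w = 1"
proof -
  have "id \<in> Sym n" by (simp add: Sym_def permutes_id)
  then show ?thesis unfolding run_sum_def by (metis comp_id)
qed

text \<open>
  The words occurring in \<open>run_sum n w\<close> are closed under the swap of positions \<open>i\<close> and \<open>i+1\<close> for
  each descent \<open>i\<close>, as these two positions have the same label.
\<close>
lemma run_sum_invariant:
  assumes "w \<in> Sym n"
  shows "(run_sum n w :: 'k::{comm_ring,comm_monoid_mult} galg) \<in> invariants n (descents n w)"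
proof -
  let ?P = "descents n w" and ?b = "run_sum n w :: 'k galg"
  define C where "C = {w \<circ> \<sigma> |\<sigma>. \<sigma> \<in> Sym n \<and> block ?P \<circ> \<sigma> = block ?P}"
  have rs: "?b u = (if u \<in> C then 1 else 0)" for u
    unfolding run_sum_def C_def by auto
  have step: "u \<circ> s i \<in> C" if "u \<in> C" "i \<in> ?P" for u i
  proof -
    obtain \<sigma> where \<sigma>: "u = w \<circ> \<sigma>" "\<sigma> \<in> Sym n" "block ?P \<circ> \<sigma> = block ?P"
      using \<open>u \<in> C\<close> by (auto simp: C_def)
    have "block ?P \<circ> s i = block ?P"
      using block_Suc[OF \<open>i \<in> ?P\<close>] by (auto simp: fun_eq_iff transpose_def)
    then have "block ?P \<circ> (\<sigma> \<circ> s i) = block ?P"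
      by (metis \<sigma>(3) comp_assoc)
    moreover have "\<sigma> \<circ> s i \<in> Sym n"
      using \<sigma>(2) \<open>i \<in> ?P\<close> by (intro Sym_comp s_in_Sym) (auto simp: descents_def)
    ultimately show ?thesis
      unfolding C_def \<sigma>(1) comp_assoc by blast
  qed
  have "u \<circ> s i \<in> C \<longleftrightarrow> u \<in> C" if "i \<in> ?P" for u i
    using step[of u i] step[of "u \<circ> s i" i] that by (auto simp: comp_assoc)
  then have "?b \<star> s i = ?b" if "i \<in> ?P" for i
    using that by (simp add: fun_eq_iff right_act_s rs)
  moreover have "C \<subseteq> Sym n" using assms by (auto simp: C_def intro: Sym_comp)
  then have "?b \<in> group_algebra n" by (auto simp: group_algebra_def rs)
  ultimately show ?thesis by (simp add: invariants_def)
qed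

definition lexless :: "(nat \<Rightarrow> nat) \<Rightarrow> (nat \<Rightarrow> nat) \<Rightarrow> bool" where
  "lexless u v \<longleftrightarrow> (\<exists>i. (\<forall>j<i. u j = v j) \<and> u i < v i)"

lemma lexless_irrefl: "\<not> lexless u u"
  by (simp add: lexless_def)

lemma lexless_trans:
  assumes "lexless u v" "lexless v w"
  shows "lexless u w"
proof -
  obtain i k where "\<forall>j<i. u j = v j" "u i < v i" "\<forall>j<k. v j = w j" "v k < w k"
    using assms by (auto simp: lexless_def)
  then have "\<forall>j<min i k. u j = w j" "u (min i k) < w (min i k)"
    by (auto simp: min_def) (metis le_neq_implies_less less_trans not_le)+
  then show ?thesis unfolding lexless_def by blast
qed

text \<open>Turns inductions along the lexicographic order on words into inductions on natural numbers.\<close>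
definition lex_rank :: "nat \<Rightarrow> (nat \<Rightarrow> nat) \<Rightarrow> nat" where
  "lex_rank n u = card {v \<in> Sym n. lexless v u}"

lemma lex_rank_less:
  assumes "u \<in> Sym n" "lexless u v"
  shows "lex_rank n u < lex_rank n v"
  unfolding lex_rank_def
proof (rule psubset_card_mono)
  have "u \<in> {x \<in> Sym n. lexless x v}" "u \<notin> {x \<in> Sym n. lexless x u}"
    using assms by (auto simp: lexless_irrefl)
  then show "{x \<in> Sym n. lexless x u} \<subset> {x \<in> Sym n. lexless x v}"
    using lexless_trans assms(2) by blast
qed simp

text \<open>
  Let \<open>i\<close> be the first position where \<open>u = w \<circ> \<sigma>\<close> takes its letter from elsewhere. All earlier
  positions are used up, so the letter comes from a later position of the same decreasing run of \<open>w\<close>,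
  and hence is smaller than \<open>w i\<close>.
\<close>
lemma run_sum_lower:
  assumes "w \<in> Sym n" "run_sum n w u \<noteq> 0" "u \<noteq> w"
  shows "lexless u w"
proof -
  let ?P = "descents n w"
  obtain \<sigma> where \<sigma>: "u = w \<circ> \<sigma>" "\<sigma> \<in> Sym n" "block ?P \<circ> \<sigma> = block ?P"
    using assms(2) by (auto simp: run_sum_def split: if_splits)
  define i where "i = (LEAST i. \<sigma> i \<noteq> i)"
  have "\<sigma> \<noteq> id" using assms(3) \<sigma>(1) by (metis comp_id)
  then have "\<exists>i. \<sigma> i \<noteq> i" by (metis ext id_apply)
  then have i: "\<sigma> i \<noteq> i" unfolding i_def by (rule LeastI_ex)
  have below: "\<sigma> j = j" if "j < i" for j using that not_less_Least unfolding i_def by blast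
  have "inj \<sigma>" using \<sigma>(2) by (auto simp: Sym_def permutes_inj)
  then have "i < \<sigma> i" using i below by (metis injD linorder_neqE_nat)
  have "block ?P i = block ?P (\<sigma> i)" using \<sigma>(3) by (metis comp_apply)
  then have desc: "w (Suc k) < w k" if "i \<le> k" "k < \<sigma> i" for k
    using block_eq_interval[of ?P i "\<sigma> i" k] that by (auto simp: descents_def)
  have "w m < w i" if "Suc i \<le> m" "m \<le> \<sigma> i" for m
    using that
  proof (induction m rule: dec_induct)
    case base
    then show ?case using desc[of i] by simp
  next
    case (step m)
    then show ?case using desc[of m] by simp
  qed
  then have "w (\<sigma> i) < w i" using \<open>i < \<sigma> i\<close> by simp
  then show ?thesis unfolding lexless_def \<sigma>(1) using below by (intro exI[of _ i]) simp
qed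

definition run_span :: "nat \<Rightarrow> (nat \<Rightarrow> nat) set \<Rightarrow> ('k::{comm_ring,comm_monoid_mult}) galg set" where
  "run_span n U = {x. \<exists>c. x = (\<Sum>u\<in>U. c u \<cdot>\<^sub>g run_sum n u)}"

lemma run_spanI: "(\<Sum>u\<in>U. c u \<cdot>\<^sub>g run_sum n u) \<in> run_span n U"
proof -
  show ?thesis unfolding run_span_def mem_Collect_eq by (rule exI[of _ c]) (rule refl)
qed
lemma run_span_0: "0 \<in> run_span n U"
proof -
  have "(0 :: 'k::{comm_ring,comm_monoid_mult} galg) = (\<Sum>u\<in>U. (\<lambda>_. 0) u \<cdot>\<^sub>g run_sum n u)"
    by (rule ext) (simp add: sum_galg_apply ga_scale_def)
  also have "\<dots> \<in> run_span n U" by (rule run_spanI)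
  finally show ?thesis .
qed

lemma run_span_add: "x \<in> run_span n U \<Longrightarrow> y \<in> run_span n U \<Longrightarrow> x + y \<in> run_span n U"
proof -
  assume "x \<in> run_span n U" "y \<in> run_span n U"
  then obtain c d where "x = (\<Sum>u\<in>U. c u \<cdot>\<^sub>g run_sum n u)" "y = (\<Sum>u\<in>U. d u \<cdot>\<^sub>g run_sum n u)"
    by (auto simp: run_span_def)
  then have "x + y = (\<Sum>u\<in>U. (c u + d u) \<cdot>\<^sub>g run_sum n u)"
    by (simp add: fun_eq_iff sum_galg_apply ga_scale_def distrib_right sum.distrib)
  then show ?thesis by (simp only: run_spanI)
qed

lemma run_span_scale: "x \<in> run_span n U \<Longrightarrow> c \<cdot>\<^sub>g x \<in> run_span n U"
proof -
  assume "x \<in> run_span n U"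
  then obtain d where "x = (\<Sum>u\<in>U. d u \<cdot>\<^sub>g run_sum n u)"
    by (auto simp: run_span_def)
  then have "c \<cdot>\<^sub>g x = (\<Sum>u\<in>U. (c * d u) \<cdot>\<^sub>g run_sum n u)"
    by (simp add: fun_eq_iff sum_galg_apply ga_scale_def sum_distrib_left mult.assoc)
  then show ?thesis by (simp only: run_spanI)
qed

lemma run_span_sum: "(\<And>i. i \<in> A \<Longrightarrow> f i \<in> run_span n U) \<Longrightarrow> (\<Sum>i\<in>A. f i) \<in> run_span n U"
  by (induction A rule: infinite_finite_induct) (auto intro: run_span_0 run_span_add)

lemma run_span_mono:
  assumes "finite V" "U \<subseteq> V"
  shows "run_span n U \<subseteq> run_span n V"
proof
  fix x assume "x \<in> run_span n U"
  then obtain c where c: "x = (\<Sum>u\<in>U. c u \<cdot>\<^sub>g run_sum n u)" by (auto simp: run_span_def)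
  have "x = (\<Sum>u\<in>V. (if u \<in> U then c u else 0) \<cdot>\<^sub>g run_sum n u)"
    unfolding c using assms by (intro sum.mono_neutral_cong_left) (auto simp: ga_scale_def)
  then show "x \<in> run_span n V"
    by (simp only: run_spanI)
qed

text \<open>
  Induction on a bound for the words occurring in \<open>q\<close>. Let \<open>u\<close> be a greatest word in \<open>q\<close>. If \<open>u\<close> had an ascent
  at some \<open>i \<in> P\<close>, then swapping there would give a greater word with the same coefficient. So \<open>P\<close> is contained
  in the descent set of \<open>u\<close>; therefore the run sum of \<open>u\<close> is itself invariant, and subtracting a
  multiple of it removes \<open>u\<close> from \<open>q\<close> and introduces only smaller words.
\<close>
lemma invariants_in_run_span:
  fixes q :: "('k::{comm_ring,comm_monoid_mult}) galg"
  assumes P: "P \<subseteq> {1..<n}" and q: "q \<in> invariants n P"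
  shows "q \<in> run_span n {w \<in> Sym n. P \<subseteq> descents n w}"
proof -
  have "q \<in> run_span n {w \<in> Sym n. P \<subseteq> descents n w}"
    if "q \<in> invariants n P" "\<And>u. q u \<noteq> 0 \<Longrightarrow> lex_rank n u < m" for q :: "'k galg" and m
    using that
  proof (induction m arbitrary: q)
    case 0
    have "q = 0" using 0 by (auto simp: fun_eq_iff)
    show ?case unfolding \<open>q = 0\<close> by (rule run_span_0)
  next
    case (Suc m)
    have Sym: "u \<in> Sym n" if "q u \<noteq> 0" for u
      using Suc.prems(1) that by (auto simp: invariants_def group_algebra_def)
    (* The words of maximal rank that occur in q; all of them are removed in one step, which
       makes it irrelevant whether distinct words can have the same rank. *)
    define T where "T = {u \<in> Sym n. lex_rank n u = m \<and> q u \<noteq> 0}"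
    have "finite T" unfolding T_def by simp
    have desc: "P \<subseteq> descents n u" if "u \<in> T" for u
    proof
      fix i assume "i \<in> P"
      then have i: "i \<in> {1..<n}" using P by auto
      have u: "u \<in> Sym n" "lex_rank n u = m" "q u \<noteq> 0" using \<open>u \<in> T\<close> by (auto simp: T_def)
      have "q (u \<circ> s i) = q u"
        using Suc.prems(1) \<open>i \<in> P\<close> by (metis (mono_tags, lifting) invariants_def mem_Collect_eq right_act_s)
      then have "lex_rank n (u \<circ> s i) \<le> lex_rank n u" 
        using Suc.prems(2)[of "u \<circ> s i"] u by (metis less_Suc_eq_le)
      then have "\<not> lexless u (u \<circ> s i)" using lex_rank_less[OF u(1)] by fastforce
      moreover have "lexless u (u \<circ> s i)" if "u i < u (Suc i)"
        unfolding lexless_def using that by (intro exI[of _ i]) auto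
      ultimately have "\<not> u i < u (Suc i)" by blast
      moreover have "inj u" using u(1) by (auto simp: Sym_def permutes_inj)
      then have "u i \<noteq> u (Suc i)" by (metis injD n_not_Suc_n)
      ultimately show "i \<in> descents n u" using i by (simp add: descents_def)
    qed
    define r where "r = q - (\<Sum>u\<in>T. q u \<cdot>\<^sub>g run_sum n u)"
    have rs: "run_sum n u \<in> invariants n P" if "u \<in> T" for u
      using run_sum_invariant invariants_mono[OF desc[OF that]] that by (auto simp: T_def)
    have "r \<in> invariants n P"
      unfolding r_def by (intro invariants_diff invariants_sum invariants_scale rs Suc.prems(1))
    moreover have "lex_rank n v < m" if "r v \<noteq> 0" for v
    proof (rule ccontr)
      assume v: "\<not> lex_rank n v < m"
      have "q u * run_sum n u v = (if u = v then q v else 0)" if "u \<in> T" for u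
      proof (cases "u = v")
        case False
        have "run_sum n u v = (0::'k)"
        proof (rule ccontr)
          assume *: "run_sum n u v \<noteq> (0::'k)"
          have "u \<in> Sym n" "lex_rank n u = m" using that by (auto simp: T_def)
          moreover have "v \<in> Sym n"
            using * run_sum_invariant[OF \<open>u \<in> Sym n\<close>]
            unfolding invariants_def group_algebra_def by blast
          ultimately show False
            using run_sum_lower[OF _ *] lex_rank_less[of v n u] False v by auto
        qed
        then show ?thesis using False by simp
      qed (simp add: run_sum_self)
      then have "(\<Sum>u\<in>T. q u * run_sum n u v) = (\<Sum>u\<in>T. if u = v then q v else 0)"
        by (rule sum.cong[OF refl])
      also have "\<dots> = (if v \<in> T then q v else 0)" using \<open>finite T\<close> by simp
      also have "\<dots> = q v"
        using Suc.prems(2)[of v] v Sym[of v] by (cases "q v = 0") (auto simp: T_def)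
      finally have "r v = 0" by (simp add: r_def sum_galg_apply ga_scale_def)
      with that show False by contradiction
    qed
    ultimately have "r \<in> run_span n {w \<in> Sym n. P \<subseteq> descents n w}" by (intro Suc.IH)
    moreover have "(\<Sum>u\<in>T. q u \<cdot>\<^sub>g run_sum n u) \<in> run_span n T" by (rule run_spanI)
    then have "(\<Sum>u\<in>T. q u \<cdot>\<^sub>g run_sum n u) \<in> run_span n {w \<in> Sym n. P \<subseteq> descents n w}"
      using run_span_mono[of "{w \<in> Sym n. P \<subseteq> descents n w}" T n] desc by (auto simp: T_def)
    ultimately have "r + (\<Sum>u\<in>T. q u \<cdot>\<^sub>g run_sum n u) \<in> run_span n {w \<in> Sym n. P \<subseteq> descents n w}"
      by (rule run_span_add)
    then show ?case by (simp add: r_def)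
  qed
  moreover have "lex_rank n u < Suc (card (Sym n))" for u
    unfolding lex_rank_def less_Suc_eq_le by (rule card_mono) auto
  ultimately show ?thesis using q by blast
qed

text \<open>
  Let \<open>v\<close> be the lexicographically greatest word whose run sum has a nonzero coefficient. Among the
  run sums with nonzero coefficients, only that of \<open>v\<close> contains the word \<open>v\<close>, so its coefficient
  cannot cancel.
\<close>
lemma run_sum_independent:
  assumes "(\<Sum>w\<in>Sym n. c w \<cdot>\<^sub>g run_sum n w) = 0" "w \<in> Sym n"
  shows "c w = 0"
proof (rule ccontr)
  let ?S = "{w \<in> Sym n. c w \<noteq> 0}"
  assume "c w \<noteq> 0"
  then have ne: "finite (lex_rank n ` ?S)" "lex_rank n ` ?S \<noteq> {}" using assms(2) by auto
  define m where "m = Max (lex_rank n ` ?S)"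
  have "m \<in> lex_rank n ` ?S" unfolding m_def by (rule Max_in[OF ne])
  then obtain v where v: "m = lex_rank n v" "v \<in> Sym n" "c v \<noteq> 0" by auto
  have max: "lex_rank n u \<le> lex_rank n v" if "u \<in> Sym n" "c u \<noteq> 0" for u
    unfolding v(1)[symmetric] m_def by (rule Max_ge[OF ne(1)]) (use that in auto)
  have "c u * run_sum n u v = (if u = v then c v else 0)" if "u \<in> Sym n" for u
  proof (cases "u = v \<or> c u = 0")
    case False
    then have "run_sum n u v = (0::'a)"
      using run_sum_lower[OF that, of v] lex_rank_less[OF v(2), of u] max[OF that] by fastforce
    then show ?thesis using False by simp
  qed (auto simp: run_sum_self)
  then have "(\<Sum>u\<in>Sym n. c u * run_sum n u v) = (\<Sum>u\<in>Sym n. if u = v then c v else 0)"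
    by (rule sum.cong[OF refl])
  also have "\<dots> = c v" using v by simp
  also have "(\<Sum>u\<in>Sym n. c u * run_sum n u v) = 0"
    using fun_cong[OF assms(1), of v] by (simp add: sum_galg_apply ga_scale_def)
  finally show False using v by simp
qed

section \<open>The filtration by levels\<close>

definition level :: "nat \<Rightarrow> (nat \<Rightarrow> nat) \<Rightarrow> nat" where
  "level n w = (LEAST k. \<exists>I\<subseteq>{..n}. \<Sum>I = k \<and> nonshadow n I \<subseteq> descents n w)"

lemma level_le: "I \<subseteq> {..n} \<Longrightarrow> nonshadow n I \<subseteq> descents n w \<Longrightarrow> level n w \<le> \<Sum>I"
  unfolding level_def by (intro Least_le exI[of _ I] conjI refl)

text \<open>The full set \<open>{..n}\<close> imposes no condition, so the minimum defining the level exists.\<close>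
lemma level_witness:
  obtains I where "I \<subseteq> {..n}" "\<Sum>I = level n w" "nonshadow n I \<subseteq> descents n w"
proof -
  have "\<exists>k. \<exists>I\<subseteq>{..n}. \<Sum>I = k \<and> nonshadow n I \<subseteq> descents n w"
    by (intro exI[of _ "\<Sum>{..n}"] exI[of _ "{..n}"]) (auto simp: nonshadow_def)
  then have "\<exists>I\<subseteq>{..n}. \<Sum>I = level n w \<and> nonshadow n I \<subseteq> descents n w"
    unfolding level_def by (rule LeastI_ex)
  then show ?thesis using that by blast
qed

lemma invariants_filtration:
  assumes "I \<subseteq> {..n}" "\<Sum>I < k"
  shows "invariants n (nonshadow n I) \<subseteq> run_span n {w \<in> Sym n. level n w < k}"
proof -
  have "nonshadow n I \<subseteq> {1..<n}" by (auto simp: nonshadow_def)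
  from invariants_in_run_span[OF this]
  have "invariants n (nonshadow n I) \<subseteq> run_span n {w \<in> Sym n. nonshadow n I \<subseteq> descents n w}" by blast
  also have "\<dots> \<subseteq> run_span n {w \<in> Sym n. level n w < k}"
  proof (rule run_span_mono)
    show "{w \<in> Sym n. nonshadow n I \<subseteq> descents n w} \<subseteq> {w \<in> Sym n. level n w < k}"
      using level_le[OF assms(1)] assms(2) by force
  qed simp
  finally show ?thesis .
qed

text \<open>
  The summands with \<open>j < p\<close>, where \<open>p\<close> is the first element of \<open>I \<union> {n+1}\<close> not below \<open>l\<close>, equal \<open>q\<close>, and
  there are \<open>p - l\<close> of them. The others are grouped into intervals between consecutive elements
  of \<open>I \<union> {n+1}\<close>, to each of which \<open>insertion_invariant\<close> applies.
\<close>
lemma cycle_sum_triangular: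
  fixes q :: "('k::{comm_ring,comm_monoid_mult}) galg"
  assumes q: "q \<in> invariants n (nonshadow n I)" and I: "I \<subseteq> {..n}" and l: "l \<in> {1..n}"
  shows "\<exists>\<mu>. (\<Sum>j=l..n. q \<star> cyc l j) - \<mu> \<cdot>\<^sub>g q \<in> run_span n {w \<in> Sym n. level n w < \<Sum>I}"
proof -
  let ?K = "insert (Suc n) I"
  have "finite I" using I finite_subset by blast
  define p where "p = (LEAST p. p \<in> ?K \<and> l \<le> p)"
  have "Suc n \<in> ?K \<and> l \<le> Suc n" using l by simp
  then have p: "p \<in> ?K" "l \<le> p" unfolding p_def by (metis (mono_tags, lifting) LeastI)+
  have p_least: "k \<notin> ?K" if "l \<le> k" "k < p" for k
    using that not_less_Least[of k "\<lambda>p. p \<in> ?K \<and> l \<le> p"] unfolding p_def by blast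
  have "p \<le> Suc n" using p I by auto
  have tail: "(\<Sum>j=p..<c. q \<star> cyc l j) \<in> run_span n {w \<in> Sym n. level n w < \<Sum>I}"
    if "c \<in> ?K" "p \<le> c" for c
    using that
  proof (induction c rule: less_induct)
    case (less c)
    show ?case
    proof (cases "p = c")
      case True
      then have "(\<Sum>j=p..<c. q \<star> cyc l j) = 0" by simp
      then show ?thesis by (simp only: run_span_0)
    next
      case False
      let ?B = "{k \<in> ?K. p \<le> k \<and> k < c}"
      define a where "a = Max ?B"
      have "finite ?B" "p \<in> ?B" using p less.prems False by auto
      then have "a \<in> ?B" unfolding a_def by (metis Max_in empty_iff)
      then have a: "a \<in> ?K" "p \<le> a" "a < c" by auto
      have a_max: "k \<le> a" if "k \<in> ?B" for k
        unfolding a_def using \<open>finite ?B\<close> that by (rule Max_ge)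
      have "c \<le> Suc n" using less.prems I by auto
      then have "a \<in> I" using a by auto
      have "I \<inter> {a<..<c} = {}" using a_max a(2) by fastforce
      then have "(\<Sum>j=a..<c. q \<star> cyc l j) \<in> invariants n (nonshadow n (shift_down l a I))"
        using l p a less.prems \<open>c \<le> Suc n\<close> \<open>a \<in> I\<close> by (intro insertion_invariant[OF q]) auto
      moreover have "shift_down l a I \<subseteq> {..n}" using I by (auto simp: shift_down_def)
      moreover have "\<Sum>(shift_down l a I) < \<Sum>I"
        using \<open>finite I\<close> \<open>a \<in> I\<close> l p a by (intro sum_shift_down) auto
      ultimately have "(\<Sum>j=a..<c. q \<star> cyc l j) \<in> run_span n {w \<in> Sym n. level n w < \<Sum>I}"
        using invariants_filtration by blast
      moreover have "(\<Sum>j=p..<c. q \<star> cyc l j)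
          = (\<Sum>j=p..<a. q \<star> cyc l j) + (\<Sum>j=a..<c. q \<star> cyc l j)"
        using a by (simp add: sum.atLeastLessThan_concat)
      ultimately show ?thesis using less.IH[of a] a by (simp only: run_span_add)
    qed
  qed
  have fixed: "q \<star> cyc l j = q" if "j \<in> {l..<p}" for j
  proof (rule invariant_cyc)
    fix i assume "i \<in> {l..<j}"
    then have "i \<in> nonshadow n I"
      using that p_least[of i] p_least[of "Suc i"] l \<open>p \<le> Suc n\<close> by (auto simp: nonshadow_def)
    then show "q \<star> s i = q" using q by (simp add: invariants_def)
  qed (use that in simp)
  (* The scalar p - l is written as a sum of ones in the coefficient ring. *)
  have "(\<Sum>j=l..n. q \<star> cyc l j) = (\<Sum>j=l..<p. q \<star> cyc l j) + (\<Sum>j=p..<Suc n. q \<star> cyc l j)"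
    using sum.atLeastLessThan_concat[OF p(2) \<open>p \<le> Suc n\<close>, of "\<lambda>j. q \<star> cyc l j"]
    by (simp only: atLeastLessThanSuc_atLeastAtMost)
  also have "(\<Sum>j=l..<p. q \<star> cyc l j) = (\<Sum>j=l..<p. q)" using fixed by (intro sum.cong) auto
  also have "\<dots> = (\<Sum>j=l..<p. 1) \<cdot>\<^sub>g q"
    by (rule ext) (simp add: sum_galg_apply ga_scale_def sum_distrib_right)
  finally have "(\<Sum>j=l..n. q \<star> cyc l j) - (\<Sum>j=l..<p. 1) \<cdot>\<^sub>g q = (\<Sum>j=p..<Suc n. q \<star> cyc l j)"
    by (simp only: add_diff_cancel_left')
  with tail[OF insertI1 \<open>p \<le> Suc n\<close>] show ?thesis
    by (intro exI[of _ "\<Sum>j=l..<p. 1"]) (simp only:)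
qed

text \<open>
  A set \<open>I\<close> attaining the level of \<open>w\<close> serves for all \<open>t l\<close> at the same time, so the triangularity
  passes to their linear combinations.
\<close>
lemma R_run_sum_triangular:
  fixes lam :: "nat \<Rightarrow> 'k::{comm_ring,comm_monoid_mult}"
  assumes w: "w \<in> Sym n"
  shows "\<exists>e. R n (\<Sum>l=1..n. lam l \<cdot>\<^sub>g t n l) (run_sum n w) = (\<Sum>u\<in>Sym n. e u \<cdot>\<^sub>g run_sum n u)
    \<and> (\<forall>u. u \<noteq> w \<longrightarrow> \<not> level n u < level n w \<longrightarrow> e u = 0)"
proof -
  let ?b = "run_sum n w :: 'k galg"
  let ?F = "run_span n {u \<in> Sym n. level n u < level n w} :: 'k galg set"
  obtain I where I: "I \<subseteq> {..n}" "\<Sum>I = level n w" "nonshadow n I \<subseteq> descents n w"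
    by (rule level_witness)
  have b: "?b \<in> invariants n (nonshadow n I)"
    using run_sum_invariant[OF w] invariants_mono[OF I(3)] by blast
  from cycle_sum_triangular[OF b I(1)]
  have "\<forall>l\<in>{1..n}. \<exists>\<mu>. (\<Sum>j=l..n. ?b \<star> cyc l j) - \<mu> \<cdot>\<^sub>g ?b \<in> ?F"
    unfolding I(2) by (rule ballI)
  from bchoice[OF this] obtain \<mu> where
    \<mu>: "\<forall>l\<in>{1..n}. (\<Sum>j=l..n. ?b \<star> cyc l j) - \<mu> l \<cdot>\<^sub>g ?b \<in> ?F" ..
  have "?b \<in> group_algebra n" using b by (simp add: invariants_def)
  then have "R n (\<Sum>l=1..n. lam l \<cdot>\<^sub>g t n l) ?b = (\<Sum>l=1..n. lam l \<cdot>\<^sub>g (\<Sum>j=l..n. ?b \<star> cyc l j))"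
    by (rule R_eq_right_act)
  also have "\<dots> = (\<Sum>l=1..n. lam l * \<mu> l) \<cdot>\<^sub>g ?b
      + (\<Sum>l=1..n. lam l \<cdot>\<^sub>g ((\<Sum>j=l..n. ?b \<star> cyc l j) - \<mu> l \<cdot>\<^sub>g ?b))"
    by (rule ext) (simp add: sum_galg_apply ga_scale_def sum_distrib_right right_diff_distrib
        sum_subtractf mult.assoc)
  finally have eq: "R n (\<Sum>l=1..n. lam l \<cdot>\<^sub>g t n l) ?b = \<dots>" .
  have "(\<Sum>l=1..n. lam l \<cdot>\<^sub>g ((\<Sum>j=l..n. ?b \<star> cyc l j) - \<mu> l \<cdot>\<^sub>g ?b)) \<in> ?F"
    by (intro run_span_sum run_span_scale bspec[OF \<mu>])
  then obtain d where "(\<Sum>l=1..n. lam l \<cdot>\<^sub>g ((\<Sum>j=l..n. ?b \<star> cyc l j) - \<mu> l \<cdot>\<^sub>g ?b))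
      = (\<Sum>u | u \<in> Sym n \<and> level n u < level n w. d u \<cdot>\<^sub>g run_sum n u)"
    by (auto simp: run_span_def)
  with eq have f: "R n (\<Sum>l=1..n. lam l \<cdot>\<^sub>g t n l) ?b = (\<Sum>l=1..n. lam l * \<mu> l) \<cdot>\<^sub>g ?b
      + (\<Sum>u | u \<in> Sym n \<and> level n u < level n w. d u \<cdot>\<^sub>g run_sum n u)" by (simp only:)
  define e where "e u = (if u = w then \<Sum>l=1..n. lam l * \<mu> l
    else if level n u < level n w then d u else 0)" for u
  have "(\<Sum>u\<in>Sym n. e u \<cdot>\<^sub>g run_sum n u)
      = e w \<cdot>\<^sub>g ?b + (\<Sum>u\<in>Sym n - {w}. e u \<cdot>\<^sub>g run_sum n u)"
    by (rule sum.remove[OF finite_Sym w])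
  also have "e w = (\<Sum>l=1..n. lam l * \<mu> l)" by (simp add: e_def)
  also have "(\<Sum>u\<in>Sym n - {w}. e u \<cdot>\<^sub>g run_sum n u)
      = (\<Sum>u | u \<in> Sym n \<and> level n u < level n w. d u \<cdot>\<^sub>g run_sum n u)"
    by (rule sum.mono_neutral_cong_right) (auto simp: e_def ga_scale_def)
  finally have "R n (\<Sum>l=1..n. lam l \<cdot>\<^sub>g t n l) ?b = (\<Sum>u\<in>Sym n. e u \<cdot>\<^sub>g run_sum n u)"
    unfolding f by (rule sym)
  moreover have "\<forall>u. u \<noteq> w \<longrightarrow> \<not> level n u < level n w \<longrightarrow> e u = 0" by (simp add: e_def)
  ultimately show ?thesis by (intro exI[of _ e] conjI)
qed

theorem theorem4p1:
  fixes n :: nat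
  shows "\<exists>vs :: ('k::{comm_ring,comm_monoid_mult}) galg list.
    length vs = fact n \<and> is_basis vs (group_algebra n) \<and>
    (\<forall>lam :: nat \<Rightarrow> 'k. \<exists>A. represents A (R n (\<Sum>l=1..n. lam l \<cdot>\<^sub>g t n l)) vs \<and> upper_triangular A)"
proof -
  obtain xs where xs: "set xs = Sym n" "distinct xs"
    using finite_distinct_list[OF finite_Sym] by blast
  define ws where "ws = sort_key (level n) xs"
  have ws: "set ws = Sym n" "distinct ws" "sorted (map (level n) ws)"
    using xs by (simp_all add: ws_def)
  define vs :: "'k galg list" where "vs = map (run_sum n) ws"
  define N where "N = length ws"
  have N: "length vs = N" by (simp add: vs_def N_def)
  have ws_in: "ws ! i \<in> Sym n" if "i < N" for i using nth_mem[of i ws] that ws(1) by (simp add: N_def)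
  have nth: "vs ! i = run_sum n (ws ! i)" if "i < N" for i using that by (simp add: vs_def N_def)
  have bij: "bij_betw (\<lambda>i. ws ! i) {..<N} (Sym n)"
    using bij_betw_nth[OF ws(2)] ws(1) by (simp add: N_def)
  have sum_ws: "(\<Sum>w\<in>Sym n. c w \<cdot>\<^sub>g run_sum n w) = (\<Sum>i<N. c (ws ! i) \<cdot>\<^sub>g vs ! i)"
    for c :: "(nat \<Rightarrow> nat) \<Rightarrow> 'k"
    by (simp add: nth flip: sum.reindex_bij_betw[OF bij])
  have "card (Sym n) = fact n"
    unfolding Sym_def by (rule card_permutations) auto
  then have "length vs = fact n"
    using distinct_card[OF ws(2)] ws(1) by (simp add: N N_def)
  moreover have "is_basis vs (group_algebra n)"
    unfolding is_basis_def N
  proof (intro conjI allI ballI impI)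
    show "set vs \<subseteq> group_algebra n"
      using run_sum_invariant ws(1) by (auto simp: vs_def invariants_def)
  next
    fix c :: "nat \<Rightarrow> 'k" and i
    assume c: "(\<Sum>i<N. c i \<cdot>\<^sub>g vs ! i) = 0" and i: "i < N"
    define c' where "c' = (\<lambda>w. c (inv_into {..<N} (\<lambda>i. ws ! i) w))"
    have c': "c' (ws ! k) = c k" if "k < N" for k
      using bij_betw_inv_into_left[OF bij, of k] that by (simp add: c'_def)
    have "(\<Sum>w\<in>Sym n. c' w \<cdot>\<^sub>g run_sum n w) = 0"
      unfolding sum_ws using c c' by simp
    from run_sum_independent[OF this ws_in[OF i]] show "c i = 0" using c' i by simp
  next
    fix x :: "'k galg" assume "x \<in> group_algebra n"
    (* Every element is invariant under the empty set of swaps. *)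
    then have "x \<in> run_span n (Sym n)" using invariants_in_run_span[of "{}" n x] by (simp add: invariants_def)
    then obtain c where "x = (\<Sum>w\<in>Sym n. c w \<cdot>\<^sub>g run_sum n w)" by (auto simp: run_span_def)
    then show "\<exists>c. x = (\<Sum>i<N. c i \<cdot>\<^sub>g vs ! i)" unfolding sum_ws by (rule exI[of _ "\<lambda>i. c (ws ! i)"])
  qed
  moreover have "\<exists>A. represents A (R n (\<Sum>l=1..n. lam l \<cdot>\<^sub>g t n l)) vs \<and> upper_triangular A"
    for lam :: "nat \<Rightarrow> 'k"
  proof -
    let ?f = "R n (\<Sum>l=1..n. lam l \<cdot>\<^sub>g t n l)"
    have "\<forall>w\<in>Sym n. \<exists>e. ?f (run_sum n w) = (\<Sum>u\<in>Sym n. e u \<cdot>\<^sub>g run_sum n u)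
        \<and> (\<forall>u. u \<noteq> w \<longrightarrow> \<not> level n u < level n w \<longrightarrow> e u = 0)"
      by (intro ballI R_run_sum_triangular)
    from bchoice[OF this] obtain e where
      e: "\<forall>w\<in>Sym n. ?f (run_sum n w) = (\<Sum>u\<in>Sym n. e w u \<cdot>\<^sub>g run_sum n u)
        \<and> (\<forall>u. u \<noteq> w \<longrightarrow> \<not> level n u < level n w \<longrightarrow> e w u = 0)" ..
    then have fe: "?f (run_sum n w) = (\<Sum>u\<in>Sym n. e w u \<cdot>\<^sub>g run_sum n u)"
      and e0: "u \<noteq> w \<Longrightarrow> \<not> level n u < level n w \<Longrightarrow> e w u = 0" if "w \<in> Sym n" for w u
      using that by blast+
    define A where "A = mat N N (\<lambda>(i, j). e (ws ! j) (ws ! i))"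
    have "represents A ?f vs"
      unfolding represents_def N
    proof (intro conjI allI impI)
      fix j assume j: "j < N"
      have "?f (vs ! j) = (\<Sum>i<N. e (ws ! j) (ws ! i) \<cdot>\<^sub>g vs ! i)"
        unfolding nth[OF j] fe[OF ws_in[OF j]] by (rule sum_ws)
      also have "\<dots> = (\<Sum>i<N. A $$ (i, j) \<cdot>\<^sub>g vs ! i)"
        by (rule sum.cong) (simp_all add: A_def j)
      finally show "?f (vs ! j) = (\<Sum>i<N. A $$ (i, j) \<cdot>\<^sub>g vs ! i)" .
    qed (simp add: A_def)
    moreover have "upper_triangular A"
    proof
      fix i j assume "j < i" "i < dim_row A"
      then have ij: "j < i" "i < N" "j < N" by (simp_all add: A_def)
      then have "ws ! i \<noteq> ws ! j" using ws(2) by (simp add: N_def nth_eq_iff_index_eq)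
      moreover have "\<not> level n (ws ! i) < level n (ws ! j)"
        using ij sorted_nth_mono[OF ws(3), of j i] by (simp add: N_def)
      ultimately have "e (ws ! j) (ws ! i) = 0" by (rule e0[OF ws_in[OF ij(3)]])
      then show "A $$ (i, j) = 0" using ij by (simp add: A_def)
    qed
    ultimately show ?thesis by blast
  qed
  ultimately show ?thesis by blast
qed

end
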